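(* Let $\mathcal{J}$ be a finite dimensional semisimple Jordan algebra over an algebraically closed field of characteristic different from $2$. Then every 2-local 1-automorphism on $\mathcal{J}$ is an automorphism.
   Context: $\mathcal{J}$ is unital with identity $1$. A symmetry is $s\in\mathcal{J}$ with $s^2=1$, and $U_s(x)=2s(sx)-x$. A 2-local 1-automorphism is a map $\Delta:\mathcal{J}\to\mathcal{J}$ (not assumed linear) such that for every $x,y\in\mathcal{J}$ there is a symmetry $s$ with $\Delta(x)=U_s(x)$ and $\Delta(y)=U_s(y)$. *)

theory Defs
  imports Main "HOL-Computational_Algebra.Polynomial"
begin

definition alg_closed_field :: "'k::field itself \<Rightarrow> bool" where
  "alg_closed_field _ \<longleftrightarrow> (\<forall>p :: 'k poly. degree p > 0 \<longrightarrow> (\<exists>x. poly p x = 0))"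

definition jordan_algebra ::
  "('k::field \<Rightarrow> 'v::ab_group_add \<Rightarrow> 'v) \<Rightarrow> ('v \<Rightarrow> 'v \<Rightarrow> 'v) \<Rightarrow> bool" where
  "jordan_algebra scale jm \<longleftrightarrow>
     vector_space scale \<and>
     (\<forall>x y z. jm (x + y) z = jm x z + jm y z) \<and>
     (\<forall>a x y. jm (scale a x) y = scale a (jm x y)) \<and>
     (\<forall>x y. jm x y = jm y x) \<and>
     (\<forall>x y. jm (jm x y) (jm x x) = jm x (jm y (jm x x)))"

definition finite_dimensional ::
  "('k::field \<Rightarrow> 'v::ab_group_add \<Rightarrow> 'v) \<Rightarrow> bool" where
  "finite_dimensional scale \<longleftrightarrow> (\<exists>B. finite B \<and> module.span scale B = UNIV)"

text \<open>Powers: jpow jm x n = x^(n+1), with x^(k+1) = x o x^k.\<close>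
fun jpow :: "('v \<Rightarrow> 'v \<Rightarrow> 'v) \<Rightarrow> 'v \<Rightarrow> nat \<Rightarrow> 'v" where
  "jpow jm x 0 = x"
| "jpow jm x (Suc n) = jm x (jpow jm x n)"

definition nilpotent_elem :: "('v::zero \<Rightarrow> 'v \<Rightarrow> 'v) \<Rightarrow> 'v \<Rightarrow> bool" where
  "nilpotent_elem jm x \<longleftrightarrow> (\<exists>n. jpow jm x n = 0)"

definition jideal ::
  "('k::field \<Rightarrow> 'v::ab_group_add \<Rightarrow> 'v) \<Rightarrow> ('v \<Rightarrow> 'v \<Rightarrow> 'v) \<Rightarrow> 'v set \<Rightarrow> bool" where
  "jideal scale jm I \<longleftrightarrow> module.subspace scale I \<and> (\<forall>x\<in>I. \<forall>y. jm x y \<in> I)"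

text \<open>Semisimple: the (nil) radical is zero, i.e. there is no nonzero nil ideal.
  (For finite-dimensional Jordan algebras nil = nilpotent = solvable radical.)\<close>
definition semisimple ::
  "('k::field \<Rightarrow> 'v::ab_group_add \<Rightarrow> 'v) \<Rightarrow> ('v \<Rightarrow> 'v \<Rightarrow> 'v) \<Rightarrow> bool" where
  "semisimple scale jm \<longleftrightarrow>
     (\<forall>I. jideal scale jm I \<and> (\<forall>x\<in>I. nilpotent_elem jm x) \<longrightarrow> I = {0})"

definition jordan_unit :: "('v \<Rightarrow> 'v \<Rightarrow> 'v) \<Rightarrow> 'v \<Rightarrow> bool" where
  "jordan_unit jm e \<longleftrightarrow> (\<forall>x. jm e x = x)"

definition symmetry :: "('v \<Rightarrow> 'v \<Rightarrow> 'v) \<Rightarrow> 'v \<Rightarrow> 'v \<Rightarrow> bool" where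
  "symmetry jm e s \<longleftrightarrow> jm s s = e"

definition U_op :: "('v::ab_group_add \<Rightarrow> 'v \<Rightarrow> 'v) \<Rightarrow> 'v \<Rightarrow> 'v \<Rightarrow> 'v" where
  "U_op jm s x = jm s (jm s x) + jm s (jm s x) - x"

definition jordan_automorphism ::
  "('k::field \<Rightarrow> 'v::ab_group_add \<Rightarrow> 'v) \<Rightarrow> ('v \<Rightarrow> 'v \<Rightarrow> 'v) \<Rightarrow> ('v \<Rightarrow> 'v) \<Rightarrow> bool" where
  "jordan_automorphism scale jm f \<longleftrightarrow>
     Vector_Spaces.linear scale scale f \<and> bij f \<and> (\<forall>x y. f (jm x y) = jm (f x) (f y))"

definition two_local_1_automorphism ::
  "('v::ab_group_add \<Rightarrow> 'v \<Rightarrow> 'v) \<Rightarrow> 'v \<Rightarrow> ('v \<Rightarrow> 'v) \<Rightarrow> bool" where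
  "two_local_1_automorphism jm e \<Delta> \<longleftrightarrow>
     (\<forall>x y. \<exists>s. symmetry jm e s \<and> \<Delta> x = U_op jm s x \<and> \<Delta> y = U_op jm s y)"

end

theory Submission
  imports Defs
begin

text \<open>
  Write \<open>U\<^sub>x y = 2x(xy) - x\<^sup>2y\<close> and call \<open>x\<close> invertible if \<open>U\<^sub>x\<close> is injective. The elements \<open>x\<close> such that
  \<open>u + x\<close> is invertible for every invertible \<open>u\<close> form a subspace, stable under \<open>U\<^sub>a\<close> for invertible
  \<open>a\<close> by the fundamental formula \<open>U\<^bsub>U\<^sub>x y\<^esub> = U\<^sub>x U\<^sub>y U\<^sub>x\<close>; as \<open>a + \<lambda>1\<close> is invertible for almost all \<open>\<lambda>\<close>,
  it is an ideal, and it is nil, hence zero. So \<open>U\<^sub>z = 0\<close> forces \<open>z = 0\<close>. In any nonzero ideal take \<open>b\<close>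
  with \<open>U\<^sub>b J\<close> of minimal dimension. Some \<open>u + b\<close> with \<open>u = v\<^sup>2\<close> invertible is not invertible, so
  \<open>y = U\<^sub>v\<inverse> b\<close> has eigenvalue \<open>-1\<close>, and minimality makes \<open>U\<^sub>y J\<close> a line spanned by an idempotent.

  If \<open>U\<^sub>c J\<close> is the line through \<open>c\<close>, then \<open>U\<^sub>c x = t\<^sub>c(x) c\<close> for a linear functional \<open>t\<^sub>c\<close>, and the common
  kernel of these functionals is an ideal, so it is zero by the above. Each \<open>U\<^sub>s\<close> with \<open>s\<^sup>2 = 1\<close> is an
  automorphism, so applying the hypothesis to the pair \<open>(c, x)\<close> gives
  \<open>t\<^bsub>\<Delta>c\<^esub>(\<Delta>x) = t\<^sub>c(x)\<close>. Comparing \<open>\<Delta>\<close> with the linear map that agrees with it on a basis shows that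
  \<open>\<Delta>\<close> is linear and bijective; it preserves squares by the pair \<open>(x, x\<^sup>2)\<close>. The trace form \<open>tr L\<^bsub>xy\<^esub>\<close> is
  avoided because it can degenerate in positive characteristic.
\<close>

section \<open>Square roots modulo a polynomial\<close>

text \<open>Hensel lifting, one linear factor at a time.\<close>

lemma sqrt_mod_poly:
  fixes f :: "'k::field poly"
  assumes closed: "alg_closed_field TYPE('k)" and two: "(2::'k) \<noteq> 0"
  shows "f \<noteq> 0 \<Longrightarrow> poly f 0 \<noteq> 0 \<Longrightarrow> \<exists>g. f dvd g * g - [:0, 1:]"
proof (induction "degree f" arbitrary: f)
  case 0
  then have "is_unit f" by (simp add: is_unit_iff_degree)
  then show ?case by (meson unit_imp_dvd)
next
  case (Suc n)
  then obtain r where r: "poly f r = 0"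
    using closed unfolding alg_closed_field_def by (metis zero_less_Suc)
  then obtain h where h: "f = [:- r, 1:] * h" by (metis dvdE poly_eq_0_iff_dvd)
  have r0: "r \<noteq> 0" using r Suc.prems by auto
  have h0: "h \<noteq> 0" "poly h 0 \<noteq> 0" using Suc.prems h by auto
  have "degree f = Suc (degree h)" unfolding h using h0 by (subst degree_mult_eq) auto
  then obtain g where "h dvd g * g - [:0, 1:]" using Suc h0 by auto
  then obtain q where q: "g * g - [:0, 1:] = h * q" by (auto simp: dvd_def)
  have qr: "poly g r * poly g r - r = poly h r * poly q r" for r
    using arg_cong[OF q, of "\<lambda>p. poly p r"] by simp
  \<comment> \<open>Replacing \<open>g\<close> by \<open>g + t h\<close> turns
    \<open>g^2 - X\<close> into \<open>h (q + 2 t g + t^2 h)\<close>, so gaining the factor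
    \<open>X - r\<close> amounts to making this cofactor vanish at \<open>r\<close>.\<close>
  have "\<exists>t. poly (q + [:2 * t:] * g + [:t * t:] * h) r = 0"
  proof (cases "poly h r = 0")
    case True
    \<comment> \<open>At a repeated root the condition on \<open>t\<close> is linear with slope
      \<open>2 g(r)\<close>, which is nonzero because \<open>g(r)^2 = r\<close>.\<close>
    then have "poly g r \<noteq> 0" using qr[of r] r0 by auto
    then show ?thesis using True two
      by (intro exI[of _ "- poly q r / (2 * poly g r)"]) simp
  next
    case False
    have "degree [:- r, 0, 1:] > 0" by simp
    then obtain s where "poly [:- r, 0, 1:] s = 0"
      using closed unfolding alg_closed_field_def by blast
    then have s: "s * s = r" by (simp add: algebra_simps)
    \<comment> \<open>With this \<open>t\<close> the polynomial \<open>g + t h\<close> takes at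
      \<open>r\<close> the value \<open>s\<close>, a square root of \<open>r\<close>.\<close>
    let ?t = "(s - poly g r) / poly h r"
    have "poly h r * (poly q r + 2 * ?t * poly g r + ?t * ?t * poly h r)
        = poly h r * poly q r + 2 * (?t * poly h r) * poly g r + (?t * poly h r) * (?t * poly h r)"
      by (simp add: algebra_simps)
    also have "?t * poly h r = s - poly g r" using False by simp
    also have "poly h r * poly q r + 2 * (s - poly g r) * poly g r + (s - poly g r) * (s - poly g r) = 0"
      unfolding qr[symmetric] s[symmetric] by (simp add: algebra_simps)
    finally show ?thesis using False by (intro exI[of _ ?t]) simp
  qed
  then obtain t where "poly (q + [:2 * t:] * g + [:t * t:] * h) r = 0" by blast
  then obtain q' where q': "q + [:2 * t:] * g + [:t * t:] * h = [:- r, 1:] * q'"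
    by (metis dvdE poly_eq_0_iff_dvd)
  have "(g + [:t:] * h) * (g + [:t:] * h) - [:0, 1:]
      = (g * g - [:0, 1:]) + h * ([:2 * t:] * g + [:t * t:] * h)"
  proof -
    have "[:2 * t:] = [:t:] + [:t:]" "[:t * t:] = [:t:] * [:t:]" by simp_all
    then show ?thesis by (simp only: algebra_simps)
  qed
  also have "\<dots> = h * (q + [:2 * t:] * g + [:t * t:] * h)"
    unfolding q by (simp only: algebra_simps)
  also have "\<dots> = f * q'" unfolding q' h by (simp only: algebra_simps)
  finally show ?case by (metis dvd_triv_left)
qed

section \<open>The fundamental formula\<close>

locale unital_jordan = vector_space scale
  for scale :: "'k::field \<Rightarrow> 'v::ab_group_add \<Rightarrow> 'v" (infixr "*s" 75) +
  fixes jm :: "'v \<Rightarrow> 'v \<Rightarrow> 'v" (infixl "\<bullet>" 70)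
    and e :: 'v
  assumes two_nz: "(2::'k) \<noteq> 0"
    and jm_add_left: "(x + y) \<bullet> z = x \<bullet> z + y \<bullet> z"
    and jm_scale_left: "(a *s x) \<bullet> y = a *s (x \<bullet> y)"
    and jm_commute: "x \<bullet> y = y \<bullet> x"
    and jordan_identity: "(x \<bullet> y) \<bullet> (x \<bullet> x) = x \<bullet> (y \<bullet> (x \<bullet> x))"
    and unit_left: "e \<bullet> x = x"
begin

lemma jm_add_right: "x \<bullet> (y + z) = x \<bullet> y + x \<bullet> z"
  by (metis jm_add_left jm_commute)

lemma jm_scale_right: "x \<bullet> (a *s y) = a *s (x \<bullet> y)"
  by (metis jm_scale_left jm_commute)

lemma jm_zero_left: "0 \<bullet> x = 0"
  using jm_add_left[of 0 0 x] by simp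

lemma jm_zero_right: "x \<bullet> 0 = 0"
  using jm_zero_left jm_commute by metis

lemma jm_minus_left: "(- x) \<bullet> y = - (x \<bullet> y)"
  using jm_add_left[of "- x" x y] by (simp add: jm_zero_left eq_neg_iff_add_eq_0)

lemma jm_minus_right: "x \<bullet> (- y) = - (x \<bullet> y)"
  using jm_minus_left jm_commute by metis

lemma jm_diff_left: "(x - y) \<bullet> z = x \<bullet> z - y \<bullet> z"
  using jm_add_left[of x "- y" z] by (simp add: jm_minus_left)

lemma jm_diff_right: "x \<bullet> (y - z) = x \<bullet> y - x \<bullet> z"
  using jm_diff_left jm_commute by metis

lemma unit_right: "x \<bullet> e = x"
  using unit_left jm_commute by metis

lemmas jm_linear = jm_add_left jm_add_right jm_zero_left jm_zero_right
  jm_minus_left jm_minus_right jm_diff_left jm_diff_right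

lemma double_eq_zero:
  fixes x :: 'v
  assumes "x + x = 0"
  shows "x = 0"
  using assms two_nz scale_left_distrib[of 1 1 x] by simp

lemma double_cancel: "(x :: 'v) + x = y + y \<Longrightarrow> x = y"
  using double_eq_zero[of "x - y"] by (simp add: algebra_simps)

section \<open>Linearisation of the Jordan identity\<close>

lemma jordan_lin1:
  "((x \<bullet> x) \<bullet> y) \<bullet> z + (((x \<bullet> z) \<bullet> y) \<bullet> x + ((x \<bullet> z) \<bullet> y) \<bullet> x)
    = (x \<bullet> x) \<bullet> (y \<bullet> z) + ((x \<bullet> z) \<bullet> (y \<bullet> x) + (x \<bullet> z) \<bullet> (y \<bullet> x))"
  (is "?l = ?r")
proof -
  define J where "J w = w \<bullet> (y \<bullet> (w \<bullet> w)) - (w \<bullet> y) \<bullet> (w \<bullet> w)" for w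
  have J0: "J w = 0" for w by (simp add: J_def jordan_identity)
  \<comment> \<open>\<open>J\<close> is cubic in its argument: \<open>J (x + z) - J (x - z)\<close>
    keeps twice the parts odd in \<open>z\<close>, and subtracting \<open>J z + J z\<close> removes
    the cubic one.\<close>
  have "J (x + z) - J (x - z) - (J z + J z) = (?l - ?r) + (?l - ?r)"
    unfolding J_def by (simp add: jm_linear algebra_simps jm_commute)
  then show ?thesis using J0 double_eq_zero by (metis diff_0_right add_0 eq_iff_diff_eq_0)
qed

text \<open>Polarising divides by 2 but never by 3, so characteristic 3 is covered.\<close>

lemma jordan_lin:
  "((x \<bullet> z) \<bullet> y) \<bullet> w + ((z \<bullet> w) \<bullet> y) \<bullet> x + ((w \<bullet> x) \<bullet> y) \<bullet> z
    = (x \<bullet> z) \<bullet> (y \<bullet> w) + (z \<bullet> w) \<bullet> (y \<bullet> x) + (w \<bullet> x) \<bullet> (y \<bullet> z)"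
  (is "?l = ?r")
proof -
  define J where "J x z = (((x \<bullet> x) \<bullet> y) \<bullet> z + (((x \<bullet> z) \<bullet> y) \<bullet> x + ((x \<bullet> z) \<bullet> y) \<bullet> x))
    - ((x \<bullet> x) \<bullet> (y \<bullet> z) + ((x \<bullet> z) \<bullet> (y \<bullet> x) + (x \<bullet> z) \<bullet> (y \<bullet> x)))" for x z
  have J0: "J x z = 0" for x z by (simp add: J_def jordan_lin1)
  have "J (x + w) z - J x z - J w z = (?l - ?r) + (?l - ?r)"
    unfolding J_def by (simp add: jm_linear algebra_simps jm_commute)
  then show ?thesis using J0 double_eq_zero by (metis diff_0_right add_0 eq_iff_diff_eq_0)
qed

section \<open>Derivations, the triple product and the operators \<open>U\<close>\<close>

definition der :: "'v \<Rightarrow> 'v \<Rightarrow> 'v \<Rightarrow> 'v" where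
  "der a b z = a \<bullet> (b \<bullet> z) - b \<bullet> (a \<bullet> z)"

definition triple :: "'v \<Rightarrow> 'v \<Rightarrow> 'v \<Rightarrow> 'v" where
  "triple x y z = (x \<bullet> y) \<bullet> z + (y \<bullet> z) \<bullet> x - (x \<bullet> z) \<bullet> y"

definition U :: "'v \<Rightarrow> 'v \<Rightarrow> 'v" where
  "U x y = x \<bullet> (x \<bullet> y) + x \<bullet> (x \<bullet> y) - (x \<bullet> x) \<bullet> y"

lemma U_eq_triple: "U x y = triple x y x"
  by (simp add: U_def triple_def jm_commute)

text \<open>The right-hand side of the linearised identity is unchanged when \<open>a\<close> and
  \<open>b\<close> are swapped, so subtracting the two versions leaves the Leibniz rule for the
  commutator of two multiplications.\<close>

lemma der_derivation: "der a b (z \<bullet> w) = der a b z \<bullet> w + z \<bullet> der a b w"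
proof -
  have "der a b (z \<bullet> w) - (der a b z \<bullet> w + z \<bullet> der a b w) =
     ((((a \<bullet> z) \<bullet> b) \<bullet> w + ((z \<bullet> w) \<bullet> b) \<bullet> a + ((w \<bullet> a) \<bullet> b) \<bullet> z)
    - ((a \<bullet> z) \<bullet> (b \<bullet> w) + (z \<bullet> w) \<bullet> (b \<bullet> a) + (w \<bullet> a) \<bullet> (b \<bullet> z)))
    - ((((b \<bullet> z) \<bullet> a) \<bullet> w + ((z \<bullet> w) \<bullet> a) \<bullet> b + ((w \<bullet> b) \<bullet> a) \<bullet> z)
    - ((b \<bullet> z) \<bullet> (a \<bullet> w) + (z \<bullet> w) \<bullet> (a \<bullet> b) + (w \<bullet> b) \<bullet> (a \<bullet> z)))"
    unfolding der_def by (simp add: jm_linear algebra_simps jm_commute)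
  then show ?thesis unfolding jordan_lin by simp
qed

lemma triple_linear:
  "triple (a + b) y z = triple a y z + triple b y z"
  "triple x (a + b) z = triple x a z + triple x b z"
  "triple x y (a + b) = triple x y a + triple x y b"
  "triple (a - b) y z = triple a y z - triple b y z"
  "triple x (a - b) z = triple x a z - triple x b z"
  "triple x y (a - b) = triple x y a - triple x y b"
  unfolding triple_def by (simp_all add: jm_linear algebra_simps)

lemma triple_commute: "triple x y z = triple z y x"
  unfolding triple_def by (simp add: jm_commute algebra_simps)

lemma triple_eq_der: "triple a b z = (a \<bullet> b) \<bullet> z + der a b z"
  unfolding triple_def der_def by (simp add: jm_commute algebra_simps)

lemma triple_swap_eq_der: "triple b a z = (a \<bullet> b) \<bullet> z - der a b z"
  unfolding triple_def der_def by (simp add: jm_commute algebra_simps)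

lemma der_triple:
  "der a b (triple u v w) = triple (der a b u) v w + triple u (der a b v) w + triple u v (der a b w)"
proof -
  have "der a b (p + q - r) = der a b p + der a b q - der a b r" for p q r
    by (simp add: der_def jm_linear algebra_simps)
  note der_add_diff = this
  show ?thesis
    unfolding triple_def der_add_diff der_derivation by (simp add: jm_linear algebra_simps jm_commute)
qed

lemma mult_triple: "c \<bullet> triple u v w = triple (c \<bullet> u) v w - triple u (c \<bullet> v) w + triple u v (c \<bullet> w)"
proof -
  have "c \<bullet> triple u v w - (triple (c \<bullet> u) v w - triple u (c \<bullet> v) w + triple u v (c \<bullet> w)) =
      (der v u (c \<bullet> w) - (der v u c \<bullet> w + c \<bullet> der v u w))
    + ((((u \<bullet> v) \<bullet> w) \<bullet> c + ((v \<bullet> c) \<bullet> w) \<bullet> u + ((c \<bullet> u) \<bullet> w) \<bullet> v)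
    - ((u \<bullet> v) \<bullet> (w \<bullet> c) + (v \<bullet> c) \<bullet> (w \<bullet> u) + (c \<bullet> u) \<bullet> (w \<bullet> v)))"
    unfolding der_def triple_def by (simp add: jm_linear algebra_simps jm_commute)
  then show ?thesis unfolding jordan_lin der_derivation by (simp add: algebra_simps)
qed

text \<open>\<open>triple a b\<close> and \<open>triple b a\<close> are multiplication by
  \<open>a \<bullet> b\<close> plus and minus \<open>der a b\<close>. Derivations enter all slots
  with a plus sign, multiplications the middle slot with a minus sign, which exchanges
  \<open>a\<close> and \<open>b\<close> there.\<close>

lemma triple_triple:
  "triple a b (triple u v w) = triple (triple a b u) v w - triple u (triple b a v) w + triple u v (triple a b w)"
  unfolding triple_eq_der[of a b] triple_swap_eq_der[of b a]
  by (simp add: triple_linear mult_triple der_triple algebra_simps)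

lemma square_mult_commute: "(x \<bullet> x) \<bullet> (x \<bullet> z) = x \<bullet> ((x \<bullet> x) \<bullet> z)"
  by (metis jordan_identity jm_commute)

lemma cube_mult:
  "((x \<bullet> x) \<bullet> x) \<bullet> z + (x \<bullet> (x \<bullet> (x \<bullet> z)) + x \<bullet> (x \<bullet> (x \<bullet> z)))
    = (x \<bullet> x) \<bullet> (x \<bullet> z) + (x \<bullet> x) \<bullet> (x \<bullet> z) + (x \<bullet> x) \<bullet> (x \<bullet> z)"
  using jordan_lin[of x x x z] by (simp add: jm_commute algebra_simps)

text \<open>In characteristic different from 3 this is a consequence of \<open>triple_triple\<close> alone.\<close>

lemma triple_U_shift: "triple x y (U x z) = U x (triple y x z)"
proof -
  \<comment> \<open>Naming the multiplication operators turns the claim into rewriting of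
    noncommuting words: \<open>XS\<close>, \<open>YS\<close> and \<open>MS\<close> move
    \<open>S\<close> to the left, \<open>C\<close> and \<open>Q\<close> eliminate the products of
    degree three.\<close>
  define X where "X = (\<lambda>u. x \<bullet> u)"
  define S where "S = (\<lambda>u. (x \<bullet> x) \<bullet> u)"
  define Y where "Y = (\<lambda>u. y \<bullet> u)"
  define M where "M = (\<lambda>u. (x \<bullet> y) \<bullet> u)"
  define C where "C = (\<lambda>u. ((x \<bullet> x) \<bullet> x) \<bullet> u)"
  define Q where "Q = (\<lambda>u. ((x \<bullet> x) \<bullet> y) \<bullet> u)"
  have add: "F (u + w) = F u + F w" "F (u - w) = F u - F w" if "F \<in> {X, S, Y, M, C, Q}" for F u w
    using that by (auto simp: X_def S_def Y_def M_def C_def Q_def jm_linear)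
  have XS: "X (S u) = S (X u)" for u
    by (simp add: X_def S_def square_mult_commute)
  have C: "C u = S (X u) + S (X u) + S (X u) - (X (X (X u)) + X (X (X u)))" for u
    using cube_mult[of x u] by (simp add: X_def S_def C_def algebra_simps)
  have Q: "Q u = S (Y u) + M (X u) + M (X u) - (X (Y (X u)) + X (Y (X u)))" for u
    using jordan_lin[of x x y u] by (simp add: X_def S_def Y_def M_def Q_def jm_commute algebra_simps)
  have YS: "Y (S u) = S (Y u) - (X (M u) + X (M u)) + M (X u) + M (X u)" for u
    using jordan_lin[of x x u y] by (simp add: X_def S_def Y_def M_def jm_commute algebra_simps)
  have MS: "M (S u) = S (M u) + X (Q u) - Q (X u) + Y (C u) - C (Y u)" for u
    using jordan_lin[of x y u "x \<bullet> x"]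
    by (simp add: X_def S_def Y_def M_def Q_def C_def jm_commute algebra_simps)
  have "triple x y (U x z) - U x (triple y x z) = 0"
  proof -
    have T1: "triple x y u = M u + X (Y u) - Y (X u)" "triple y x u = M u - X (Y u) + Y (X u)" for u
      by (simp_all add: X_def Y_def M_def triple_def jm_commute algebra_simps)
    have U1: "U x u = X (X u) + X (X u) - S u" for u
      by (simp add: X_def S_def U_def)
    show ?thesis
      unfolding T1 U1
      by (simp add: add XS YS MS Q C algebra_simps)
  qed
  then show ?thesis by simp
qed

text \<open>Expanding by \<open>triple_triple\<close> leaves terms in which
  \<open>triple_U_shift\<close> moves \<open>U x\<close> to the front. \<open>P\<close> and
  \<open>Q\<close>, two further instances, identify what remains under \<open>U x\<close> as
  \<open>U y (U x z)\<close>.\<close>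

lemma fundamental: "U (U x y) z = U x (U y (U x z))"
proof -
  have shift: "triple x a (U x b) = U x (triple a x b)" for a b by (rule triple_U_shift)
  have P: "U y (U x z) = triple y x (triple y x z) + triple y x (triple y x z) - triple (U y x) x z"
    using triple_triple[of z x y x y] unfolding U_eq_triple
    by (simp add: triple_commute algebra_simps)
  have Q: "triple y (U x y) z = triple (U y x) x z"
    using triple_triple[of y x y x z] unfolding U_eq_triple
    by (simp add: triple_commute algebra_simps)
  have "U (U x y) z = triple (U x y) z (triple x y x)"
    by (simp add: U_eq_triple)
  also have "\<dots> = triple (triple (U x y) z x) y x - triple x (triple z (U x y) y) x + triple x y (triple (U x y) z x)"
    by (rule triple_triple)
  also have "triple (U x y) z x = U x (triple y x z)"
    using shift[of z y] by (simp add: triple_commute)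
  finally have "U (U x y) z = triple x y (U x (triple y x z)) + triple x y (U x (triple y x z))
     - U x (triple y (U x y) z)"
    by (simp add: triple_commute U_eq_triple)
  also have "\<dots> = U x (triple y x (triple y x z) + triple y x (triple y x z) - triple y (U x y) z)"
    unfolding shift by (simp add: U_def jm_linear algebra_simps)
  finally show ?thesis unfolding P Q .
qed

section \<open>Polynomials in one element\<close>

lemma scale_two: "2 *s x = x + x"
  using scale_left_distrib[of 1 1 x] by simp

lemma U_add_right: "U x (y + z) = U x y + U x z"
  and U_scale_right: "U x (a *s y) = a *s U x y"
  and U_zero_right: "U x 0 = 0"
  and U_diff_right: "U x (y - z) = U x y - U x z"
  unfolding U_def
  by (simp_all add: jm_linear jm_scale_right scale_right_distrib scale_right_diff_distrib algebra_simps)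

lemma U_scale_left: "U (a *s x) y = (a * a) *s U x y"
  unfolding U_def
  by (simp add: jm_scale_left jm_scale_right scale_right_distrib scale_right_diff_distrib)

lemma U_unit_left: "U e y = y"
  by (simp add: U_def unit_left)

lemma U_unit_right: "U x e = x \<bullet> x"
  by (simp add: U_def unit_right)

lemma U_zero_left: "U 0 y = 0"
  by (simp add: U_def jm_linear)

lemma U_add_unit: "U (x + a *s e) y = U x y + (2 * a) *s (x \<bullet> y) + (a * a) *s y"
proof -
  have "(2 * a) *s z = a *s z + a *s z" for z
    by (metis mult.commute scale_scale scale_two scale_right_distrib)
  then show ?thesis
    unfolding U_def
    by (simp add: jm_linear jm_scale_left jm_scale_right unit_left unit_right scale_right_distrib
        jm_commute algebra_simps)
qed

lemma linear_U: "Vector_Spaces.linear (*s) (*s) (U x)"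
  by (unfold_locales) (simp_all add: U_add_right U_scale_right)

lemma subspace_range_U: "subspace (range (U x))"
  by (rule subspaceI)
    (auto simp: image_iff U_add_right[symmetric] U_scale_right[symmetric] intro: exI[of _ 0] U_zero_right)

lemma U_square: "U (x \<bullet> x) y = U x (U x y)"
  using fundamental[of x e y] by (simp add: U_unit_left U_unit_right)

section \<open>Power associativity and evaluation of polynomials\<close>

fun pow :: "'v \<Rightarrow> nat \<Rightarrow> 'v" where
  "pow x 0 = e"
| "pow x (Suc n) = x \<bullet> pow x n"

lemma jpow_eq_pow: "jpow jm x n = pow x (Suc n)"
  by (induction n) (simp_all add: unit_right)

text \<open>The linearised identity expresses multiplication by a power through \<open>x\<close>,
  \<open>x \<bullet> x\<close> and the two preceding powers. As \<open>x \<bullet> x\<close> occurs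
  there, both commutation rules go through the induction together.\<close>

lemma pow_commute:
  "pow x n \<bullet> (x \<bullet> y) = x \<bullet> (pow x n \<bullet> y) \<and> pow x n \<bullet> ((x \<bullet> x) \<bullet> y) = (x \<bullet> x) \<bullet> (pow x n \<bullet> y)"
proof (induction n arbitrary: y rule: induct_nat_012)
  case 0
  show ?case by (simp add: unit_left)
next
  case 1
  show ?case by (simp add: unit_right square_mult_commute)
next
  case (ge2 n)
  let ?P = "pow x n" and ?Q = "pow x (Suc n)"
  have comm: "?P \<bullet> (x \<bullet> u) = x \<bullet> (?P \<bullet> u)" "?P \<bullet> ((x \<bullet> x) \<bullet> u) = (x \<bullet> x) \<bullet> (?P \<bullet> u)"
    "?Q \<bullet> (x \<bullet> u) = x \<bullet> (?Q \<bullet> u)" "?Q \<bullet> ((x \<bullet> x) \<bullet> u) = (x \<bullet> x) \<bullet> (?Q \<bullet> u)" for u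
    using ge2 by blast+
  have rec: "pow x (Suc (Suc n)) \<bullet> u = x \<bullet> (?Q \<bullet> u) + x \<bullet> (?Q \<bullet> u) + (x \<bullet> x) \<bullet> (?P \<bullet> u)
      - (x \<bullet> (x \<bullet> (?P \<bullet> u)) + x \<bullet> (x \<bullet> (?P \<bullet> u)))" for u
  proof -
    have "pow x (Suc (Suc n)) \<bullet> u + x \<bullet> (x \<bullet> (?P \<bullet> u)) + ?P \<bullet> (x \<bullet> (x \<bullet> u))
      = ?Q \<bullet> (x \<bullet> u) + (x \<bullet> x) \<bullet> (?P \<bullet> u) + ?Q \<bullet> (x \<bullet> u)"
      using jordan_lin[of x ?P x u] by (simp add: jm_commute algebra_simps)
    then show ?thesis unfolding comm by (simp add: algebra_simps)
  qed
  show ?case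
    unfolding rec by (simp add: comm jm_linear square_mult_commute del: pow.simps)
qed

text \<open>Horner evaluation of \<open>f\<close> at \<open>x\<close>, with \<open>e\<close>
  carrying the constant terms.\<close>

definition ev :: "'v \<Rightarrow> 'k poly \<Rightarrow> 'v" where
  "ev x f = fold_coeffs (\<lambda>a v. a *s e + x \<bullet> v) f 0"

lemma ev_0 [simp]: "ev x 0 = 0"
  by (simp add: ev_def)

lemma ev_pCons [simp]: "ev x (pCons a f) = a *s e + x \<bullet> ev x f"
proof -
  have "a = 0 \<and> f = 0 \<or> a \<noteq> 0 \<or> f \<noteq> 0" by blast
  then show ?thesis
    unfolding ev_def by (elim disjE) (simp_all add: jm_zero_right fold_coeffs_def)
qed

lemma ev_add: "ev x (f + g) = ev x f + ev x g"
  by (induction f g rule: poly_induct2) (simp_all add: scale_left_distrib jm_linear algebra_simps)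

lemma ev_smult: "ev x (smult a f) = a *s ev x f"
  by (induction f) (simp_all add: scale_right_distrib jm_scale_right)

lemma ev_diff: "ev x (f - g) = ev x f - ev x g"
  using ev_add[of x "f - g" g] by simp

lemma ev_monom: "ev x (monom a n) = a *s pow x n"
  by (induction n) (simp_all add: monom_0 monom_Suc jm_scale_right jm_zero_right)

lemma ev_sum: "ev x (\<Sum>i\<in>A. f i) = (\<Sum>i\<in>A. ev x (f i))"
  by (induction A rule: infinite_finite_induct) (simp_all add: ev_add)

lemma ev_commute: "ev x f \<bullet> (x \<bullet> y) = x \<bullet> (ev x f \<bullet> y)"
proof -
  have "ev x f = (\<Sum>i\<le>degree f. coeff f i *s pow x i)"
    by (subst poly_as_sum_of_monoms[symmetric]) (simp only: ev_sum ev_monom)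
  moreover have "(\<Sum>i\<in>A. c i *s pow x i) \<bullet> (x \<bullet> y) = x \<bullet> ((\<Sum>i\<in>A. c i *s pow x i) \<bullet> y)"
    if "finite A" for A and c :: "nat \<Rightarrow> 'k"
    using that
    by (induction A) (simp_all add: jm_linear jm_scale_left jm_scale_right pow_commute)
  ultimately show ?thesis by simp
qed

text \<open>Power associativity: multiplication by a polynomial in \<open>x\<close> commutes with
  multiplication by \<open>x\<close>, so factors \<open>x\<close> can be regrouped one at a
  time.\<close>

lemma ev_mult: "ev x (f * g) = ev x f \<bullet> ev x g"
proof (induction f)
  case (pCons a f)
  have "ev x (pCons a f * g) = a *s ev x g + x \<bullet> (ev x f \<bullet> ev x g)"
    by (simp add: ev_add ev_smult pCons.IH)
  also have "x \<bullet> (ev x f \<bullet> ev x g) = (x \<bullet> ev x f) \<bullet> ev x g"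
    by (metis ev_commute jm_commute)
  finally show ?case by (simp add: jm_linear jm_scale_left unit_left)
qed (simp add: jm_linear)

lemma ev_X: "ev x [:0, 1:] = x"
  by (simp add: jm_zero_right unit_right)

lemma U_ev: "U (ev x f) (ev x g) = ev x (f * f * g)"
  unfolding U_def ev_mult[symmetric] by (simp add: algebra_simps)

lemma ev_linear_factor: "ev x [:- a, 1:] = x - a *s e"
  by (simp add: jm_zero_right unit_right)

section \<open>Invertible elements\<close>

definition invertible :: "'v \<Rightarrow> bool" where
  "invertible x \<longleftrightarrow> (\<forall>y. U x y = 0 \<longrightarrow> y = 0)"

lemma U_eq_0_iff: "invertible x \<Longrightarrow> U x y = 0 \<longleftrightarrow> y = 0"
  unfolding invertible_def using U_zero_right by blast

lemma invertible_iff: "invertible x \<longleftrightarrow> (\<forall>y. U x y = 0 \<longleftrightarrow> y = 0)"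
  unfolding invertible_def using U_zero_right by blast

lemma invertible_inj: "invertible x \<Longrightarrow> inj (U x)"
  unfolding inj_def by (metis U_diff_right U_eq_0_iff eq_iff_diff_eq_0)

text \<open>As \<open>f\<close> does not vanish at \<open>r\<close>, the factor \<open>X - r\<close>
  has an inverse \<open>b\<close> modulo \<open>f\<close>. Then \<open>U (x - r *s e)\<close> sends
  the value of \<open>b^2\<close> to \<open>e\<close>, and the fundamental formula yields
  injectivity.\<close>

lemma invertible_shift:
  assumes "ev x f = 0" and "poly f r \<noteq> 0"
  shows "invertible (x - r *s e)"
proof -
  have "[:- r, 1:] dvd f - [:poly f r:]" by (simp add: poly_eq_0_iff_dvd[symmetric])
  then obtain g where g: "f - [:poly f r:] = [:- r, 1:] * g" by (auto simp: dvd_def)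
  define b where "b = smult (- inverse (poly f r)) g"
  have "ev x ([:- r, 1:] * g) = - (poly f r) *s e"
    unfolding g[symmetric] using assms by (simp add: ev_diff jm_zero_right)
  then have one: "ev x ([:- r, 1:] * b) = e"
    unfolding b_def mult_smult_right ev_smult using assms by simp
  have "U (x - r *s e) (ev x (b * b)) = ev x (([:- r, 1:] * b) * ([:- r, 1:] * b))"
    unfolding ev_linear_factor[symmetric] U_ev by (simp only: ac_simps)
  also have "\<dots> = e" using one ev_mult unit_left by metis
  finally have "y = U (x - r *s e) (U (ev x (b * b)) (U (x - r *s e) y))" for y
    using fundamental U_unit_left by metis
  then show ?thesis unfolding invertible_def using U_zero_right by metis
qed

lemma invertible_unit: "invertible e"
  by (simp add: invertible_iff U_unit_left)

lemma invertible_scale: "a \<noteq> 0 \<Longrightarrow> invertible x \<Longrightarrow> invertible (a *s x)"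
  by (simp add: invertible_iff U_scale_left)

lemma invertible_U: "invertible x \<Longrightarrow> invertible y \<Longrightarrow> invertible (U x y)"
  by (simp add: invertible_iff fundamental)

end

locale fd_jordan = unital_jordan scale jm e + finite_dimensional_vector_space scale Basis
  for scale :: "'k::field \<Rightarrow> 'v::ab_group_add \<Rightarrow> 'v" (infixr "*s" 75)
    and jm :: "'v \<Rightarrow> 'v \<Rightarrow> 'v" (infixl "\<bullet>" 70) and e :: 'v and Basis :: "'v set" +
  assumes closed: "alg_closed_field TYPE('k)"
begin

lemma poly_root: "degree (f :: 'k poly) > 0 \<Longrightarrow> \<exists>r. poly f r = 0"
  using closed by (simp add: alg_closed_field_def)

lemma invertible_surj: "invertible x \<Longrightarrow> surj (U x)"
  using linear_inj_imp_surj[OF linear_U] invertible_inj by blast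

lemma invertible_arg_of_U:
  assumes "invertible x" "invertible (U x y)"
  shows "invertible y"
  unfolding invertible_def
proof (intro allI impI)
  fix z assume z: "U y z = 0"
  obtain w where w: "z = U x w" using invertible_surj[OF assms(1)] by (metis surjD)
  have "U (U x y) w = 0" using z by (simp add: w fundamental U_zero_right)
  then have "w = 0" using U_eq_0_iff[OF assms(2)] by simp
  then show "z = 0" by (simp add: w U_zero_right)
qed

lemma annihilator_exists: "\<exists>f. f \<noteq> 0 \<and> ev x f = 0"
proof (cases "inj_on (pow x) {..card Basis}")
  case False
  then obtain i j where ij: "i \<noteq> j" "pow x i = pow x j" by (auto simp: inj_on_def)
  then have "coeff (monom (1::'k) i - monom 1 j) i \<noteq> 0" by simp
  then have "monom (1::'k) i - monom 1 j \<noteq> 0" by (metis coeff_0)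
  then show ?thesis using ij by (intro exI[of _ "monom 1 i - monom 1 j"]) (simp add: ev_diff ev_monom)
next
  case True
  \<comment> \<open>One power more than the dimension, hence linearly dependent.\<close>
  let ?V = "pow x ` {..card Basis}"
  have "card ?V = Suc (card Basis)" using True by (simp add: card_image)
  then have "dependent ?V" using independent_card_le_dim[of ?V UNIV] by auto
  then obtain u v where u: "(\<Sum>v\<in>?V. u v *s v) = 0" "v \<in> ?V" "u v \<noteq> 0"
    using dependent_finite[of ?V] by auto
  then obtain i where i: "i \<le> card Basis" "u (pow x i) \<noteq> 0" by auto
  define f where "f = (\<Sum>i\<le>card Basis. monom (u (pow x i)) i)"
  have "ev x f = (\<Sum>v\<in>?V. u v *s v)"
    unfolding f_def ev_sum ev_monom using True by (simp add: sum.reindex)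
  moreover have "coeff f i = u (pow x i)"
    unfolding f_def using i by (simp add: coeff_sum)
  ultimately show ?thesis using u(1) i by (metis coeff_0)
qed

section \<open>Minimal polynomials and square roots\<close>

definition minpoly :: "'v \<Rightarrow> 'k poly \<Rightarrow> bool" where
  "minpoly x f \<longleftrightarrow> f \<noteq> 0 \<and> ev x f = 0 \<and> (\<forall>g. g \<noteq> 0 \<and> ev x g = 0 \<longrightarrow> degree f \<le> degree g)"

lemma minpoly_exists: "\<exists>f. minpoly x f"
  using ex_has_least_nat[of "\<lambda>f. f \<noteq> 0 \<and> ev x f = 0" _ degree] annihilator_exists[of x]
  unfolding minpoly_def by blast

text \<open>By minimality of the degree the cofactor of \<open>X - r\<close> does not vanish at
  \<open>x\<close>, so its value is an eigenvector.\<close>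

lemma minpoly_root:
  assumes "minpoly x f" "poly f r = 0"
  obtains h where "f = [:- r, 1:] * h" "ev x h \<noteq> 0" "x \<bullet> ev x h = r *s ev x h"
proof -
  obtain h where h: "f = [:- r, 1:] * h" using assms(2) by (metis dvdE poly_eq_0_iff_dvd)
  have h0: "h \<noteq> 0" using h assms(1) by (auto simp: minpoly_def)
  have "degree f = Suc (degree h)" unfolding h using h0 by (subst degree_mult_eq) auto
  then have "ev x h \<noteq> 0" using assms(1) h0 by (auto simp: minpoly_def)
  moreover have "(x - r *s e) \<bullet> ev x h = 0"
    using assms(1) h ev_mult ev_linear_factor by (metis minpoly_def)
  then have "x \<bullet> ev x h = r *s ev x h" by (simp add: jm_linear jm_scale_left unit_left)
  ultimately show ?thesis using h that by blast
qed

lemma minpoly_root_not_invertible: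
  assumes "minpoly x f" "poly f r = 0"
  shows "\<not> invertible (x - r *s e)"
proof -
  obtain h where h: "f = [:- r, 1:] * h" "ev x h \<noteq> 0" using minpoly_root assms by metis
  have "U (x - r *s e) (ev x h) = ev x ([:- r, 1:] * f)"
    unfolding ev_linear_factor[symmetric] U_ev h(1) by (simp only: ac_simps)
  also have "\<dots> = 0" unfolding ev_mult using assms(1) by (simp add: minpoly_def jm_zero_right)
  finally show ?thesis using h(2) U_eq_0_iff by blast
qed

text \<open>Over an algebraically closed field a polynomial without nonzero roots is a scalar times
  a power of \<open>X\<close>.\<close>

lemma pow_eq_0:
  assumes "minpoly x f" "\<And>r. poly f r = 0 \<Longrightarrow> r = 0"
  shows "\<exists>n. pow x n = 0"
proof -
  have f0: "f \<noteq> 0" "ev x f = 0" using assms(1) by (auto simp: minpoly_def)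
  obtain g where g: "f = [:- 0, 1:] ^ order 0 f * g" "\<not> [:- 0, 1:] dvd g"
    using order_decomp[OF f0(1)] by blast
  have g0: "g \<noteq> 0" "poly g 0 \<noteq> 0" using g(2) poly_eq_0_iff_dvd[of g 0] by auto
  have "degree g = 0"
  proof (rule ccontr)
    assume "degree g \<noteq> 0"
    then obtain r where "poly g r = 0" using poly_root by blast
    then have "poly f r = 0" by (subst g(1)) simp
    then show False using assms(2) g0 \<open>poly g r = 0\<close> by blast
  qed
  then obtain c where c: "g = [:c:]" by (metis degree_eq_zeroE)
  have "[:- 0, 1::'k:] ^ n = monom 1 n" for n
    by (induction n) (simp_all add: monom_Suc)
  then have "f = monom c (order 0 f)"
    by (subst g(1)) (simp add: c smult_monom)
  then have "c *s pow x (order 0 f) = 0" using f0 ev_monom by metis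
  then show ?thesis using c g0 by auto
qed

text \<open>Invertibility of \<open>u\<close> keeps 0 from being a root of its minimal polynomial,
  so \<open>X\<close> has a square root modulo it. Its value \<open>v\<close> is invertible because
  \<open>U u\<close> is the square of \<open>U v\<close>.\<close>

lemma invertible_sqrt:
  assumes u: "invertible u"
  obtains v where "v \<bullet> v = u" "invertible v"
proof -
  obtain f where f: "minpoly u f" using minpoly_exists by blast
  have "poly f 0 \<noteq> 0" using minpoly_root_not_invertible[OF f, of 0] u by auto
  then obtain g where "f dvd g * g - [:0, 1:]"
    using sqrt_mod_poly[OF closed two_nz] f by (metis minpoly_def)
  then obtain q where "g * g - [:0, 1:] = f * q" by (auto simp: dvd_def)
  then have "ev u (g * g) - ev u [:0, 1:] = ev u f \<bullet> ev u q"
    by (metis ev_diff ev_mult)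
  then have g: "ev u g \<bullet> ev u g = u"
    using f by (simp add: minpoly_def jm_linear ev_mult unit_right)
  moreover have "invertible (ev u g)"
    unfolding invertible_def using u by (metis g U_square U_zero_right U_eq_0_iff)
  ultimately show ?thesis using that by blast
qed

lemma two_invertible_shifts:
  obtains r s where "r \<noteq> s" "invertible (x + r *s e)" "invertible (x + s *s e)"
proof -
  obtain f where f: "f \<noteq> 0" "ev x f = 0" using annihilator_exists by blast
  \<comment> \<open>A root of \<open>f g - 1\<close> is a root of neither \<open>f\<close> nor
    \<open>g\<close>; taking \<open>g = X - r\<close> afterwards yields a second point different
    from \<open>r\<close>.\<close>
  have "\<exists>r. poly f r * poly g r = 1" if "degree g > 0" for g
  proof -
    have "degree (f * g - 1) > 0"
    proof -
      have "degree (f * g) = degree f + degree g" using f that by (intro degree_mult_eq) auto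
      then show ?thesis
        using that degree_add_eq_left[of "-1" "f * g"] by simp
    qed
    then obtain r where "poly (f * g - 1) r = 0" using poly_root by blast
    then show ?thesis by auto
  qed
  note ex = this
  obtain r where r: "poly f r * poly [:0, 1:] r = 1" using ex[of "[:0, 1:]"] by auto
  obtain s where s: "poly f s * poly [:- r, 1:] s = 1" using ex[of "[:- r, 1:]"] by auto
  have "- r \<noteq> - s" "poly f r \<noteq> 0" "poly f s \<noteq> 0" using r s by auto
  moreover have "invertible (x + (- t) *s e)" if "poly f t \<noteq> 0" for t
    using invertible_shift[OF f(2) that] by simp
  ultimately show ?thesis using that by blast
qed

text \<open>With \<open>w\<close> solving \<open>U v w = e\<close>, the fundamental formula makes
  \<open>U w\<close> the inverse square of \<open>U v\<close>.\<close>

lemma U_inverse: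
  assumes "invertible v"
  obtains w where "\<And>y. U v (U v (U w y)) = y"
proof -
  obtain w where "e = U v w" using invertible_surj[OF assms] by (metis surjD)
  then have w: "U v (U w (U v y)) = y" for y using fundamental U_unit_left by metis
  have "U v (U v (U w y)) = y" for y
  proof -
    obtain z where "y = U v z" using invertible_surj[OF assms] by (metis surjD)
    then show ?thesis using w by simp
  qed
  then show ?thesis using that by blast
qed

section \<open>The radical and rank one elements\<close>

definition ideal :: "'v set \<Rightarrow> bool" where
  "ideal I \<longleftrightarrow> jideal (*s) (\<bullet>) I"

lemma ideal_iff: "ideal I \<longleftrightarrow> subspace I \<and> (\<forall>x\<in>I. \<forall>y. y \<bullet> x \<in> I)"
  unfolding ideal_def jideal_def by (simp add: jm_commute)

lemma ideal_U: "ideal I \<Longrightarrow> x \<in> I \<Longrightarrow> U y x \<in> I"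
  unfolding ideal_iff U_def by (simp add: subspace_add subspace_diff)

lemma ideal_U_left: "ideal I \<Longrightarrow> x \<in> I \<Longrightarrow> U x y \<in> I"
  unfolding ideal_iff U_def by (metis jm_commute subspace_add subspace_diff)

text \<open>\<open>U (a + r *s e) x\<close> is a quadratic polynomial in \<open>r\<close> with
  linear coefficient \<open>2 (a \<bullet> x)\<close>; two shifts that make \<open>a\<close>
  invertible isolate this coefficient.\<close>

lemma idealI_invertible:
  assumes S: "subspace I" and U: "\<And>a x. invertible a \<Longrightarrow> x \<in> I \<Longrightarrow> U a x \<in> I"
  shows "ideal I"
  unfolding ideal_iff
proof (intro conjI ballI allI S)
  fix x a assume x: "x \<in> I"
  obtain r s where rs: "r \<noteq> s" "invertible (a + r *s e)" "invertible (a + s *s e)"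
    using two_invertible_shifts by blast
  have "U (a + r *s e) x - (r * r) *s x - (U (a + s *s e) x - (s * s) *s x) \<in> I"
    using S U x rs by (intro subspace_diff subspace_scale) auto
  also have "U (a + r *s e) x - (r * r) *s x - (U (a + s *s e) x - (s * s) *s x)
      = (2 * (r - s)) *s (a \<bullet> x)"
    unfolding U_add_unit by (simp add: algebra_simps)
  finally have "inverse (2 * (r - s)) *s (2 * (r - s)) *s (a \<bullet> x) \<in> I"
    using S subspace_scale by blast
  moreover have "2 * (r - s) \<noteq> 0" using rs(1) two_nz by simp
  ultimately show "a \<bullet> x \<in> I" by simp
qed

definition radical :: "'v set" where
  "radical = {x. \<forall>u. invertible u \<longrightarrow> invertible (u + x)}"

lemma ideal_radical: "ideal radical"
proof (rule idealI_invertible)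
  show "subspace radical"
  proof (rule subspaceI)
    show "0 \<in> radical" by (simp add: radical_def)
    show "x + y \<in> radical" if "x \<in> radical" "y \<in> radical" for x y
      using that by (simp add: radical_def add.assoc[symmetric])
    show "c *s x \<in> radical" if x: "x \<in> radical" for c x
    proof (cases "c = 0")
      case False
      have "u + c *s x = c *s (inverse c *s u + x)" for u
        using False by (simp add: scale_right_distrib)
      then show ?thesis using x False by (simp add: radical_def invertible_scale)
    qed (simp add: radical_def)
  qed
  show "U a x \<in> radical" if a: "invertible a" and x: "x \<in> radical" for a x
    unfolding radical_def
  proof (intro CollectI allI impI)
    fix u assume u: "invertible u"
    obtain w where w: "u = U a w" using invertible_surj[OF a] by (metis surjD)
    then have "invertible w" using u a invertible_arg_of_U by blast
    then have "invertible (w + x)" using x by (simp add: radical_def)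
    then show "invertible (u + U a x)" using a invertible_U w by (metis U_add_right)
  qed
qed

text \<open>A nonzero root \<open>r\<close> of the minimal polynomial would make
  \<open>x - r *s e\<close> singular, although it is an invertible element plus an element of the
  radical.\<close>

lemma radical_nil:
  assumes "x \<in> radical"
  shows "nilpotent_elem jm x"
proof -
  obtain f where f: "minpoly x f" using minpoly_exists by blast
  have "r = 0" if r: "poly f r = 0" for r
  proof (rule ccontr)
    assume "r \<noteq> 0"
    then have "invertible ((- r) *s e)" by (intro invertible_scale invertible_unit) simp
    then have "invertible ((- r) *s e + x)" using assms unfolding radical_def by blast
    then show False using minpoly_root_not_invertible[OF f r] by simp
  qed
  then obtain n where "pow x n = 0" using pow_eq_0 f by blast
  then show ?thesis
    \<comment> \<open>\<open>jpow\<close> at \<open>n\<close> is one power beyond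
      \<open>pow x n\<close>, so it vanishes too.\<close>
    unfolding nilpotent_elem_def jpow_eq_pow by (intro exI[of _ n]) (simp add: jm_zero_right)
qed

text \<open>For \<open>u = v \<bullet> v\<close> the map \<open>U v\<close> pulls
  \<open>u + z\<close> back to \<open>e + z'\<close> with \<open>U z' = 0\<close>. Multiplication by
  \<open>z'\<close> then squares to zero, so \<open>U (e + z')\<close>, the identity plus twice this
  multiplication, is injective.\<close>

lemma trivial_in_radical:
  assumes z: "\<And>y. U z y = 0"
  shows "z \<in> radical"
  unfolding radical_def
proof (intro CollectI allI impI)
  fix u assume "invertible u"
  then obtain v where v: "v \<bullet> v = u" "invertible v" using invertible_sqrt by blast
  obtain z' where z': "z = U v z'" using invertible_surj[OF v(2)] by (metis surjD)
  have tz: "U z' y = 0" for y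
  proof -
    obtain w where "y = U v w" using invertible_surj[OF v(2)] by (metis surjD)
    then have "U v (U z' y) = 0" using z[of w] by (simp add: z' fundamental)
    then show ?thesis by (simp add: U_eq_0_iff[OF v(2)])
  qed
  have sq: "z' \<bullet> z' = 0" using tz U_unit_right by metis
  have "invertible (z' + 1 *s e)"
    unfolding invertible_def
  proof (intro allI impI)
    fix y assume "U (z' + 1 *s e) y = 0"
    then have y: "2 *s (z' \<bullet> y) + y = 0" unfolding U_add_unit by (simp add: tz)
    have "z' \<bullet> (z' \<bullet> y) = 0"
      by (rule double_eq_zero) (use tz[of y] in \<open>simp add: U_def sq jm_zero_left\<close>)
    moreover have "z' \<bullet> (2 *s (z' \<bullet> y) + y) = 0" using y by (simp add: jm_zero_right)
    ultimately have "z' \<bullet> y = 0" by (simp add: jm_linear jm_scale_right)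
    then show "y = 0" using y by simp
  qed
  then have "invertible (U v (e + z'))" using v(2) by (simp add: invertible_U add.commute)
  then show "invertible (u + z)" using v(1) z' by (simp add: U_add_right U_unit_right)
qed

section \<open>Idempotents, minimal inner ideals and rank one elements\<close>

lemma idempotent_in_range_U: "p \<bullet> p = p \<Longrightarrow> p \<in> range (U p)"
  by (rule range_eqI[of _ _ e]) (simp add: U_unit_right)

text \<open>\<open>range (U p)\<close> is the Peirce 1-space of \<open>p\<close>: multiplication
  \<open>L\<close> by \<open>p\<close> satisfies \<open>2 L^3 - 3 L^2 + L = 0\<close> and
  \<open>U p\<close> is \<open>2 L^2 - L\<close>.\<close>

lemma idempotent_U_range:
  assumes p: "p \<bullet> p = p" and x: "x \<in> range (U p)"
  shows "U p x = x" "p \<bullet> x = x"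
proof -
  obtain y where y: "x = U p y" using x by blast
  show "U p x = x" using U_square[of p y] by (simp add: p y)
  have "p \<bullet> y + (p \<bullet> (p \<bullet> (p \<bullet> y)) + p \<bullet> (p \<bullet> (p \<bullet> y)))
      = p \<bullet> (p \<bullet> y) + p \<bullet> (p \<bullet> y) + p \<bullet> (p \<bullet> y)"
    using cube_mult[of p y] by (simp add: p)
  then show "p \<bullet> x = x" unfolding y U_def by (simp add: p jm_linear algebra_simps)
qed

definition minimal :: "'v \<Rightarrow> bool" where
  "minimal x \<longleftrightarrow> (\<forall>c\<in>range (U x). c \<noteq> 0 \<longrightarrow> range (U c) = range (U x))"

lemma range_U_mono: "c \<in> range (U x) \<Longrightarrow> range (U c) \<subseteq> range (U x)"
  by (auto simp: fundamental)

definition rank_one :: "'v \<Rightarrow> bool" where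
  "rank_one c \<longleftrightarrow> c \<noteq> 0 \<and> (\<forall>y. \<exists>k. U c y = k *s c)"

definition rank_one_annihilator :: "'v set" where
  "rank_one_annihilator = {x. \<forall>c. rank_one c \<longrightarrow> U c x = 0}"

text \<open>An invertible \<open>a\<close> sends rank one elements to rank one elements under
  \<open>U a\<close>, and \<open>U a (U c (U a x))\<close> is \<open>U (U a c) x\<close>.\<close>

lemma ideal_rank_one_annihilator: "ideal rank_one_annihilator"
proof (rule idealI_invertible)
  show "subspace rank_one_annihilator"
    by (rule subspaceI) (simp_all add: rank_one_annihilator_def U_zero_right U_add_right U_scale_right)
  show "U a x \<in> rank_one_annihilator" if a: "invertible a" and x: "x \<in> rank_one_annihilator" for a x
    unfolding rank_one_annihilator_def
  proof (intro CollectI allI impI)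
    fix c assume c: "rank_one c"
    have "U a c \<noteq> 0" using c by (simp add: U_eq_0_iff[OF a] rank_one_def)
    moreover have "\<exists>k. U (U a c) y = k *s U a c" for y
      unfolding fundamental using c by (metis rank_one_def U_scale_right)
    ultimately have "rank_one (U a c)" by (simp add: rank_one_def)
    then have "U a (U c (U a x)) = 0"
      using x unfolding rank_one_annihilator_def fundamental[symmetric] by blast
    then show "U c (U a x) = 0" by (simp add: U_eq_0_iff[OF a])
  qed
qed

section \<open>Rank one idempotents in nondegenerate algebras\<close>

context
  assumes radical_zero: "radical = {0}"
begin

lemma nondegenerate: "(\<And>y. U z y = 0) \<Longrightarrow> z = 0"
  using trivial_in_radical radical_zero by blast

text \<open>If \<open>q\<close> is nonzero, minimality lets every \<open>U x a\<close> be written as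
  \<open>U q d\<close>. Then \<open>U q a\<close> is a multiple of \<open>U x (U q (U q d))\<close>,
  which vanishes because \<open>U q\<close> squares to \<open>U (q \<bullet> q) = 0\<close>; this
  contradicts nondegeneracy.\<close>

lemma minimal_square_zero:
  assumes min: "minimal x" and q: "q = k *s U x q" and sq: "q \<bullet> q = 0"
  shows "q = 0"
proof (rule ccontr)
  assume q0: "q \<noteq> 0"
  have "U x (k *s q) = q" unfolding U_scale_right using q by (rule sym)
  then have "q \<in> range (U x)" by (metis rangeI)
  then have range_q: "range (U q) = range (U x)" using min q0 unfolding minimal_def by blast
  have "\<exists>d. U x a = U q d" for a
  proof -
    have "U x a \<in> range (U q)" unfolding range_q by (rule rangeI)
    then show ?thesis by blast
  qed
  then obtain d where d: "\<And>a. U x a = U q (d a)" by metis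
  have "U q a = 0" for a
  proof -
    have "U q a = (k * k) *s U (U x q) a" using U_scale_left q by metis
    also have "\<dots> = (k * k) *s U x (U q (U q (d a)))" by (simp only: fundamental d[of a])
    also have "\<dots> = 0" using U_square[of q "d a"] by (simp add: sq U_zero_left U_zero_right)
    finally show ?thesis .
  qed
  then show False using nondegenerate q0 by blast
qed

text \<open>The eigenvector \<open>h(x)\<close> is multiplied by \<open>h(r)\<close> when squared,
  and \<open>h(r)\<close> is nonzero by \<open>minimal_square_zero\<close>; dividing by it gives the
  idempotent.\<close>

lemma minimal_eigenvalue_idempotent:
  assumes min: "minimal x" and f: "minpoly x f" and r: "poly f r = 0" "r \<noteq> 0"
  obtains p where "p \<noteq> 0" "p \<bullet> p = p" "range (U p) = range (U x)" "x \<bullet> p = r *s p"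
proof -
  obtain h where h: "f = [:- r, 1:] * h" "ev x h \<noteq> 0" "x \<bullet> ev x h = r *s ev x h"
    using minpoly_root[OF f r(1)] by blast
  let ?q = "ev x h"
  have act: "ev x g \<bullet> ?q = poly g r *s ?q" for g
  proof (induction g)
    case (pCons a g)
    have "(x \<bullet> ev x g) \<bullet> ?q = x \<bullet> (ev x g \<bullet> ?q)"
      using ev_commute[of x h "ev x g"] by (simp only: jm_commute)
    also have "\<dots> = (r * poly g r) *s ?q"
      unfolding pCons.IH by (simp add: jm_scale_right h(3) mult.commute)
    finally show ?case
      by (simp add: jm_add_left jm_scale_left unit_left scale_left_distrib)
  qed (simp add: jm_zero_left)
  have "U x ?q = ev x ([:0, 1:] * [:0, 1:]) \<bullet> ?q"
    using U_ev[of x "[:0, 1:]" h] unfolding ev_X by (simp only: ev_mult)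
  then have Uq: "U x ?q = (r * r) *s ?q" unfolding act by simp
  have "r * r \<noteq> 0" using r(2) by simp
  then have q: "?q = inverse (r * r) *s U x ?q" unfolding Uq by (metis scale_scale left_inverse scale_one)
  have qq: "?q \<bullet> ?q = poly h r *s ?q" by (rule act)
  then have hr: "poly h r \<noteq> 0" using minimal_square_zero[OF min q] h(2) by auto
  define p where "p = inverse (poly h r) *s ?q"
  have p0: "p \<noteq> 0" using hr h(2) by (simp add: p_def)
  have "p = U x (inverse (poly h r) *s inverse (r * r) *s ?q)"
    unfolding p_def U_scale_right using q by metis
  then have "p \<in> range (U x)" by blast
  then have "range (U p) = range (U x)" using min p0 unfolding minimal_def by blast
  moreover have "p \<bullet> p = p" using hr by (simp add: p_def jm_scale_left jm_scale_right qq)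
  moreover have "x \<bullet> p = r *s p" by (simp add: p_def jm_scale_right h(3) mult.commute)
  ultimately show ?thesis using that p0 by blast
qed

lemma minimal_idempotent_no_nilpotent:
  assumes min: "minimal p" and p: "p \<bullet> p = p" and x: "x \<in> range (U p)" and nil: "pow x n = 0"
  shows "x = 0"
proof (rule ccontr)
  assume x0: "x \<noteq> 0"
  define m where "m = (LEAST n. pow x n = 0)"
  have m: "pow x m = 0" unfolding m_def using nil by (rule LeastI)
  have less: "pow x i \<noteq> 0" if "i < m" for i using that not_less_Least unfolding m_def by blast
  have "e \<noteq> 0" using x0 unit_left jm_zero_left by metis
  then have "m \<noteq> 0" using m by (metis pow.simps(1))
  moreover have "m \<noteq> 1" using m x0 by (auto simp: unit_right)
  ultimately obtain j where j: "m = Suc (Suc j)" by (metis One_nat_def not0_implies_Suc)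
  \<comment> \<open>The last nonzero power of \<open>x\<close>; its square has exponent
    \<open>2 m - 2\<close>, at least \<open>m\<close> since \<open>m\<close> is at least 2.\<close>
  define w where "w = pow x (Suc j)"
  have w0: "w \<noteq> 0" using less[of "Suc j"] j by (simp add: w_def)
  have ev: "pow x i = ev x (monom 1 i)" for i by (simp add: ev_monom)
  have "w \<bullet> w = pow x m \<bullet> pow x j"
    unfolding w_def ev ev_mult[symmetric] by (simp add: mult_monom j)
  then have sq: "w \<bullet> w = 0" by (simp add: m jm_zero_left)
  have "w \<in> range (U p)"
  proof (cases j)
    case 0
    then show ?thesis using x by (simp add: w_def unit_right)
  next
    case (Suc i)
    have "U x (pow x i) = U (ev x (monom 1 1)) (ev x (monom 1 i))"
      by (simp add: ev_monom unit_right)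
    also have "\<dots> = w" unfolding U_ev w_def Suc ev by (simp add: mult_monom)
    finally show ?thesis using range_U_mono[OF x] by blast
  qed
  then have "U p w = w" by (rule idempotent_U_range(1)[OF p])
  then have "w = 1 *s U p w" by (simp only: scale_one)
  from minimal_square_zero[OF min this sq] w0 show False by contradiction
qed

text \<open>A nonzero element of the range is not nilpotent, so it has a nonzero eigenvalue and an
  eigenvector \<open>q\<close> that is an idempotent with the same range. Both \<open>p\<close> and
  \<open>q\<close> act as identity on that range, hence coincide.\<close>

lemma minimal_idempotent_rank_one:
  assumes min: "minimal p" and p: "p \<bullet> p = p" "p \<noteq> 0"
  shows "rank_one p"
  unfolding rank_one_def
proof (intro conjI allI p)
  fix y
  let ?x = "U p y"
  show "\<exists>k. ?x = k *s p"
  proof (cases "?x = 0")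
    case True
    then show ?thesis by (intro exI[of _ 0]) simp
  next
    case False
    have range_x: "range (U ?x) = range (U p)" using min False by (simp add: minimal_def)
    have minx: "minimal ?x" using min unfolding minimal_def range_x .
    obtain f where f: "minpoly ?x f" using minpoly_exists by blast
    have "\<exists>r. poly f r = 0 \<and> r \<noteq> 0"
    proof (rule ccontr)
      assume "\<not> ?thesis"
      then have "r = 0" if "poly f r = 0" for r using that by blast
      from pow_eq_0[OF f this] obtain n where "pow ?x n = 0" by blast
      from minimal_idempotent_no_nilpotent[OF min p(1) rangeI this] False
      show "False" by contradiction
    qed
    then obtain r where r: "poly f r = 0" "r \<noteq> 0" by blast
    from minimal_eigenvalue_idempotent[OF minx f r]
    obtain q where "q \<noteq> 0"
      and q: "q \<bullet> q = q" "range (U q) = range (U ?x)" "?x \<bullet> q = r *s q" .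
    note mem = idempotent_in_range_U[OF p(1)] idempotent_in_range_U[OF q(1)]
    have qp: "q \<bullet> p = p"
      by (rule idempotent_U_range(2)[OF q(1)]) (unfold q(2) range_x, rule mem(1))
    have pq: "p \<bullet> q = q"
      by (rule idempotent_U_range(2)[OF p(1)]) (rule mem(2)[unfolded q(2) range_x])
    have qx: "q \<bullet> ?x = ?x"
      by (rule idempotent_U_range(2)[OF q(1)]) (unfold q(2) range_x, rule rangeI)
    have "p = q \<bullet> p" by (rule qp[symmetric])
    also have "\<dots> = p \<bullet> q" by (rule jm_commute)
    also have "\<dots> = q" by (rule pq)
    finally have "p = q" .
    have "?x = q \<bullet> ?x" by (rule qx[symmetric])
    also have "\<dots> = ?x \<bullet> q" by (rule jm_commute)
    also have "\<dots> = r *s q" by (rule q(3))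
    finally have "?x = r *s p" unfolding \<open>p = q\<close> .
    then show ?thesis by (rule exI)
  qed
qed

text \<open>An element \<open>b\<close> of \<open>M\<close> with smallest range is minimal but may
  be nilpotent. Lying outside the radical, it can be moved within \<open>M\<close> to a minimal
  element with eigenvalue \<open>-1\<close>.\<close>

lemma ideal_contains_rank_one_idempotent:
  assumes M: "ideal M" and "M \<noteq> {0}"
  obtains p where "p \<in> M" "p \<bullet> p = p" "rank_one p"
proof -
  have sub: "subspace M" using M by (simp add: ideal_iff)
  then have "\<exists>b. b \<in> M \<and> b \<noteq> 0" using assms(2) subspace_0 by blast
  then obtain b where b: "b \<in> M" "b \<noteq> 0"
    and least: "\<And>c. c \<in> M \<Longrightarrow> c \<noteq> 0 \<Longrightarrow> dim (range (U b)) \<le> dim (range (U c))"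
    using ex_has_least_nat[of "\<lambda>b. b \<in> M \<and> b \<noteq> 0" _ "\<lambda>b. dim (range (U b))"] by metis
  have min_b: "minimal b"
    unfolding minimal_def
  proof (intro ballI impI)
    fix c assume c: "c \<in> range (U b)" "c \<noteq> 0"
    then have "c \<in> M" using ideal_U_left[OF M b(1)] by blast
    then show "range (U c) = range (U b)"
      using least c range_U_mono[OF c(1)] by (intro subspace_dim_equal subspace_range_U) auto
  qed
  have "b \<notin> radical" using radical_zero b(2) by simp
  then obtain u where u: "invertible u" "\<not> invertible (u + b)" by (auto simp: radical_def)
  obtain v where v: "v \<bullet> v = u" "invertible v" using invertible_sqrt u(1) by blast
  obtain w where w: "\<And>y. U v (U v (U w y)) = y" using U_inverse v(2) by blast
  \<comment> \<open>The preimage of \<open>b\<close> under \<open>U v\<close>, written with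
    \<open>U\<close> operators applied to \<open>b\<close> so that it stays in
    \<open>M\<close>.\<close>
  define y where "y = U v (U w b)"
  have Uy: "U v y = b" by (simp add: y_def w)
  have yM: "y \<in> M" using M b(1) by (simp add: y_def ideal_U)
  \<comment> \<open>Since \<open>U v\<close> is bijective, this transfers minimality from
    \<open>b = U v y\<close> to \<open>y\<close>.\<close>
  have range_conj: "range (U (U v c)) = U v ` range (U c)" for c
  proof -
    have "U (U v c) = U v \<circ> U c \<circ> U v" by (simp add: fun_eq_iff fundamental)
    then have "range (U (U v c)) = U v ` U c ` range (U v)" by (simp only: image_comp comp_assoc)
    then show ?thesis by (simp only: invertible_surj[OF v(2)])
  qed
  have min: "minimal y"
    unfolding minimal_def
  proof (intro ballI impI)
    fix c assume c: "c \<in> range (U y)" "c \<noteq> 0"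
    have "U v c \<in> range (U b)" using c(1) range_conj[of y] by (simp add: Uy)
    moreover have "U v c \<noteq> 0" using c(2) by (simp add: U_eq_0_iff[OF v(2)])
    ultimately have "range (U (U v c)) = range (U b)" using min_b unfolding minimal_def by blast
    then have "U v ` range (U c) = U v ` range (U y)" using range_conj Uy by metis
    then show "range (U c) = range (U y)"
      using invertible_inj[OF v(2)] by (simp add: inj_image_eq_iff)
  qed
  obtain f where f: "minpoly y f" using minpoly_exists by blast
  have "\<not> invertible (y - (- 1) *s e)"
  proof
    assume "invertible (y - (- 1) *s e)"
    then have "invertible (U v (e + y))" using v(2) by (simp add: invertible_U add.commute)
    then show False using u(2) v(1) Uy by (simp add: U_add_right U_unit_right)
  qed
  then have root: "poly f (- 1) = 0" using invertible_shift f by (metis minpoly_def)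
  have "(- 1 :: 'k) \<noteq> 0" by simp
  from minimal_eigenvalue_idempotent[OF min f root this]
  obtain p where p: "p \<noteq> 0" "p \<bullet> p = p" "range (U p) = range (U y)" "y \<bullet> p = - 1 *s p" .
  have "p \<in> range (U y)" using idempotent_in_range_U[OF p(2)] p(3) by simp
  then have "p \<in> M" using ideal_U_left[OF M yM] by blast
  moreover have "minimal p" using min unfolding minimal_def p(3) .
  ultimately show ?thesis using that p minimal_idempotent_rank_one by blast
qed

text \<open>A nonzero common kernel would be an ideal containing a rank one idempotent
  \<open>p\<close>, yet \<open>U p p = p\<close>.\<close>

lemma rank_one_separates:
  assumes "\<And>c. rank_one c \<Longrightarrow> U c x = 0"
  shows "x = 0"
proof -
  have "rank_one_annihilator = {0}"
  proof (rule ccontr)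
    assume "rank_one_annihilator \<noteq> {0}"
    then obtain p where p: "p \<in> rank_one_annihilator" "p \<bullet> p = p" "rank_one p"
      using ideal_contains_rank_one_idempotent ideal_rank_one_annihilator by blast
    then have "U p p = 0" by (simp add: rank_one_annihilator_def)
    moreover have "U p p = p" using p(2) by (simp add: U_def)
    ultimately show False using p(3) by (simp add: rank_one_def)
  qed
  then show ?thesis using assms by (auto simp: rank_one_annihilator_def)
qed

section \<open>Linearity and multiplicativity of two-local maps\<close>

lemma two_local_automorphism:
  assumes loc: "two_local_1_automorphism jm e \<Delta>"
  shows "jordan_automorphism (*s) jm \<Delta>"
proof -
  have "\<exists>s. s \<bullet> s = e \<and> \<Delta> x = U s x \<and> \<Delta> y = U s y" for x y
  proof -
    obtain s where "s \<bullet> s = e" "\<Delta> x = U_op jm s x" "\<Delta> y = U_op jm s y"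
      using loc unfolding two_local_1_automorphism_def symmetry_def by blast
    moreover have "U_op jm s z = U s z" for z
      using \<open>s \<bullet> s = e\<close> by (simp add: U_op_def U_def unit_left)
    ultimately show ?thesis by auto
  qed
  note loc = this
  have involution: "U s (U s x) = x" if "s \<bullet> s = e" for s x
    using U_square[of s x] by (simp add: that U_unit_left)
  have U_conj: "U (U s x) (U s y) = U s (U x y)" if "s \<bullet> s = e" for s x y
    by (simp add: fundamental involution[OF that])
  \<comment> \<open>One symmetry \<open>s\<close> realises \<open>\<Delta>\<close> at both
    \<open>c\<close> and \<open>x\<close>, and \<open>U s\<close> is compatible with forming
    \<open>U c x\<close>, so the scalar is preserved.\<close>
  have coeff: "U (\<Delta> c) (\<Delta> x) = k *s \<Delta> c" if "U c x = k *s c" for c x k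
    using loc[of c x] that by (auto simp: U_conj U_scale_right)
  have nz: "\<Delta> c \<noteq> 0" if "rank_one c" for c
    using loc[of c c] that involution by (metis rank_one_def U_zero_right)
  interpret vector_space_pair "(*s)" "(*s)" by unfold_locales
  define \<Phi> where "\<Phi> = construct Basis \<Delta>"
  interpret \<Phi>: Vector_Spaces.linear "(*s)" "(*s)" \<Phi>
    unfolding \<Phi>_def by (rule linear_construct[OF independent_Basis])
  have \<Phi>_coeff: "\<exists>k. U c x = k *s c \<and> U (\<Delta> c) (\<Phi> x) = k *s \<Delta> c" if c: "rank_one c" for c x
  proof -
    \<comment> \<open>Both scalars are linear in \<open>x\<close>, so it suffices to compare them on
      the basis, where \<open>\<Phi>\<close> and \<open>\<Delta>\<close> agree.\<close>
    let ?S = "{x. \<exists>k. U c x = k *s c \<and> U (\<Delta> c) (\<Phi> x) = k *s \<Delta> c}"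
    have "subspace ?S"
    proof (rule subspaceI)
      show "0 \<in> ?S" by (auto simp: U_zero_right \<Phi>.zero intro: exI[of _ 0])
      show "x + y \<in> ?S" if "x \<in> ?S" "y \<in> ?S" for x y
        using that by (auto simp: U_add_right \<Phi>.add scale_left_distrib[symmetric])
      show "a *s x \<in> ?S" if "x \<in> ?S" for a x
        using that by (auto simp: U_scale_right \<Phi>.scale)
    qed
    moreover have "Basis \<subseteq> ?S"
    proof
      fix b assume "b \<in> Basis"
      then have "\<Phi> b = \<Delta> b" unfolding \<Phi>_def by (rule construct_basis[OF independent_Basis])
      moreover obtain k where "U c b = k *s c" using c unfolding rank_one_def by blast
      ultimately show "b \<in> ?S" using coeff by auto
    qed
    ultimately have "span Basis \<subseteq> ?S" by (rule span_minimal[rotated])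
    then show ?thesis using span_Basis by auto
  qed
  have "inj \<Phi>"
  proof (rule injI)
    fix x y assume "\<Phi> x = \<Phi> y"
    then have "\<Phi> (x - y) = 0" by (simp add: \<Phi>.diff)
    then have "U c (x - y) = 0" if "rank_one c" for c
      using \<Phi>_coeff[OF that, of "x - y"] nz[OF that] by (auto simp: U_zero_right)
    then show "x = y" using rank_one_separates[of "x - y"] by simp
  qed
  then have surj: "surj \<Phi>" using linear_inj_imp_surj \<Phi>.linear_axioms by blast
  have "\<Delta> x = \<Phi> x" for x
  proof -
    \<comment> \<open>Additivity of \<open>\<Delta>\<close> is still open, so \<open>x\<close> is
      compared with a preimage of \<open>\<Delta> x\<close> under the linear map: all their rank one
      scalars agree.\<close>
    obtain y where y: "\<Delta> x = \<Phi> y" using surj by (metis surjD)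
    have "U c (x - y) = 0" if c: "rank_one c" for c
    proof -
      obtain k where k: "U c y = k *s c" "U (\<Delta> c) (\<Phi> y) = k *s \<Delta> c"
        using \<Phi>_coeff[OF c] by blast
      obtain l where l: "U c x = l *s c" using c by (auto simp: rank_one_def)
      have "l *s \<Delta> c = k *s \<Delta> c" using coeff[OF l] k(2) unfolding y by (rule trans[OF sym])
      then have "l = k" using nz[OF c] by simp
      then show ?thesis using k(1) l by (simp add: U_diff_right)
    qed
    then have "x = y" using rank_one_separates[of "x - y"] by simp
    then show ?thesis using y by simp
  qed
  then have \<Delta>: "\<Delta> = \<Phi>" by blast
  have square: "\<Delta> (x \<bullet> x) = \<Delta> x \<bullet> \<Delta> x" for x
  proof -
    \<comment> \<open>A common symmetry for \<open>x\<close> and its square; as \<open>U s\<close>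
      fixes \<open>e\<close>, applying \<open>U_conj\<close> to \<open>U x e\<close> gives the
      square of \<open>\<Delta> x\<close>.\<close>
    obtain s where s: "s \<bullet> s = e" "\<Delta> x = U s x" "\<Delta> (x \<bullet> x) = U s (x \<bullet> x)"
      using loc by blast
    have "U s e = e" using s(1) by (simp add: U_unit_right)
    then show ?thesis using U_conj[OF s(1), of x e] s by (simp add: U_unit_right)
  qed
  have "\<Delta> (x \<bullet> y) = \<Delta> x \<bullet> \<Delta> y" for x y
  proof (rule double_cancel)
    show "\<Delta> (x \<bullet> y) + \<Delta> (x \<bullet> y) = \<Delta> x \<bullet> \<Delta> y + \<Delta> x \<bullet> \<Delta> y"
      using square[of "x + y"] square[of x] square[of y]
      by (simp add: \<Delta> \<Phi>.add jm_linear jm_commute algebra_simps)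
  qed
  then show ?thesis
    unfolding jordan_automorphism_def
    using \<Phi>.linear_axioms \<open>inj \<Phi>\<close> surj by (auto simp: \<Delta> bij_def)
qed

end

end

theorem theorem4p9:
  fixes scale :: "'k::field \<Rightarrow> 'v::ab_group_add \<Rightarrow> 'v"
    and jm :: "'v \<Rightarrow> 'v \<Rightarrow> 'v"
    and e :: 'v
    and \<Delta> :: "'v \<Rightarrow> 'v"
  assumes "alg_closed_field TYPE('k)"
    and "(2::'k) \<noteq> 0"
    and "jordan_algebra scale jm"
    and "finite_dimensional scale"
    and "semisimple scale jm"
    and "jordan_unit jm e"
    and "two_local_1_automorphism jm e \<Delta>"
  shows "jordan_automorphism scale jm \<Delta>"
proof -
  interpret vector_space scale
    using assms(3) by (simp add: jordan_algebra_def)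
  interpret unital_jordan scale jm e
    using assms(2,3,6) unfolding jordan_algebra_def jordan_unit_def
    by unfold_locales blast+
  obtain B where B: "finite B" "span B = UNIV"
    using assms(4) by (auto simp: finite_dimensional_def)
  obtain Basis where Basis: "Basis \<subseteq> B" "independent Basis" "B \<subseteq> span Basis"
    using maximal_independent_subset[of B] by blast
  interpret fd_jordan scale jm e Basis
  proof unfold_locales
    show "finite Basis" using Basis(1) B(1) by (rule finite_subset)
    show "span Basis = UNIV"
      using span_minimal[OF Basis(3) subspace_span] B(2) by auto
  qed (use Basis assms(1) in auto)
  have "radical = {0}"
    using assms(5) ideal_radical radical_nil unfolding semisimple_def ideal_def by blast
  then show ?thesis using assms(7) by (rule two_local_automorphism)
qed

end
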